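(* Let $K\in\mathbb{R}_{>0}$. Consider a problem instance in the class $I_{\text{sub}}$ such that for every $t\in\mathcal{T}$ we have $f^t(x^t)=a^t\bar{f}^t\big(\frac{x^t}{a^t}+b^t\big)$ with $\bar{f}^t(y)=Ke^y$ and parameters $a^t\in\mathbb{R}_{>0}$, $b^t\in\mathbb{R}$. Let $(\mu^*,\lambda^* )$ be optimal Lagrange multipliers and let $(\hat{\mu},\hat{\lambda})$ be Lagrange multipliers with $(\hat{\mu},\hat{\lambda})\le(\mu^*,\lambda^* )$ component-wise. Assume that for every $t\in\mathcal{T}$ the values $\nu^t(\hat{\mu},\hat{\lambda})$ and $\nu^t(\mu^*,\lambda^* )$ lie in the range of $\nabla f^t$. Then $$\sum_{t \in \mathcal{T}} f^t\big((\nabla f^t)^{-1}(\nu^t(\hat{\mu},\hat{\lambda}))\big) - \sum_{t \in \mathcal{T}} f^t\big((\nabla f^t)^{-1}(\nu^t(\mu^*,\lambda^* ))\big)=\sum_{t \in \mathcal{T}} a^t \nu^t(\hat{\mu},\hat{\lambda}) - \sum_{t \in \mathcal{T}} a^t \nu^t(\mu^*,\lambda^* ),$$ and consequently $$\sum_{t \in \mathcal{T}} f^t (\hat{x}^t(\hat{\mu},\hat{\lambda})) - \sum_{t \in \mathcal{T}} f^t (\hat{x}^t(\mu^*,\lambda^* )) \leq \sum_{t \in \mathcal{T}} a^t \nu^t(\hat{\mu},\hat{\lambda}) - \sum_{t \in \mathcal{T}} a^t \nu^t(\mu^*,\lambda^* ).$$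
   Context: Let $T\ge 1$ be an integer and $\mathcal{T}=\{1,\ldots,T\}$. A function $r:2^{\mathcal{T}}\to\mathbb{R}$ is submodular if $r(\mathcal{X}\cup\mathcal{Y})+r(\mathcal{X}\cap\mathcal{Y})\le r(\mathcal{X})+r(\mathcal{Y})$ for all $\mathcal{X},\mathcal{Y}\subseteq\mathcal{T}$; we assume $r(\emptyset)=0$. Its base polyhedron is $\mathcal{B}(r)=\{x\in\mathbb{R}^T : \sum_{t\in\mathcal{X}}x^t\le r(\mathcal{X})\ \forall \mathcal{X}\subset\mathcal{T},\ \sum_{t\in\mathcal{T}}x^t=r(\mathcal{T})\}$ (superscripts on $x$, $a$, $b$, $f$, $\nu$ are indices). The class $I_{\text{sub}}$ consists of all problems $\min \sum_{t\in\mathcal{T}} f^t(x^t)$ subject to $x=(x^1,\ldots,x^T)\in\mathcal{B}(r)$, where $r$ is submodular on $\mathcal{T}$ and each $f^t$ is a real-valued increasing, strictly convex, continuously differentiable function of one real variable, defined on an interval $D^t\subseteq\mathbb{R}$ containing $\mathcal{C}^t:=[\,r(\mathcal{T})-r(\mathcal{T}\setminus\{t\}),\ r(\{t\})\,]$. Lagrange multipliers: let $\mathcal{M}=\{\mathcal{X}\subseteq\mathcal{T}: 1<|\mathcal{X}|<T\}$. A vector of Lagrange multipliers is $(\mu,\lambda)$ with $\mu=(\mu_{\mathcal{X}})_{\mathcal{X}\in\mathcal{M}}$ (for the constraints $\sum_{t\in\mathcal{X}}x^t\le r(\mathcal{X})$) and a scalar $\lambda=\lambda_{\mathcal{T}}$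 (for the constraint $\sum_{t\in\mathcal{T}}x^t=r(\mathcal{T})$). Put $\nu^t(\mu,\lambda):=-\sum_{\mathcal{X}\in\mathcal{M}:\,\mathcal{X}\ni t}\mu_{\mathcal{X}}-\lambda_{\mathcal{T}}$. Up to an additive constant, the local Lagrangian of stage $t$ is $L^t(x^t,\mu,\lambda)=f^t(x^t)-\nu^t(\mu,\lambda)\,x^t$. Local Lagrangian solution: $x^t(\mu,\lambda)$ is the unique minimizer of $L^t(\cdot,\mu,\lambda)$ over $\mathcal{C}^t$. The multipliers $(\mu^*,\lambda^* )$ are called optimal if $(x^t(\mu^*,\lambda^* ))_{t\in\mathcal{T}}$ is an optimal solution of the problem instance; it is assumed throughout that such multipliers exist. Online solution: $\hat{x}(\mu,\lambda)=(\hat{x}^1(\mu,\lambda),\ldots,\hat{x}^T(\mu,\lambda))$ is defined recursively for $\bar t=1,\ldots,T$: $\hat{x}^{\bar t}(\mu,\lambda)$ is the unique minimizer of $L^{\bar t}(\cdot,\mu,\lambda)$ over the set $\mathcal{C}^{\bar t}_{\text{proj}}$ of all $y\in\mathbb{R}$ for which there exist $x^{\bar t+1},\ldots,x^T$ with $(\hat{x}^1(\mu,\lambda),\ldots,\hat{x}^{\bar t-1}(\mu,\lambda),y,x^{\bar t+1},\ldots,x^T)\in\mathcal{B}(r)$. $\nabla f^t$ denotes the derivative of $f^t$ on $D^t$ (one-sided at endpoints of $D^t$ that belong to it), and $(\nabla f^t)^{-1}$ is its inverse, defined on the range of $\nabla f^t$ and taking values in $D^t$. *)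

theory Defs
  imports "HOL-Analysis.Analysis"
begin

definition submodular_on :: "'a set \<Rightarrow> ('a set \<Rightarrow> real) \<Rightarrow> bool" where
  "submodular_on S r \<longleftrightarrow>
     (\<forall>X Y. X \<subseteq> S \<longrightarrow> Y \<subseteq> S \<longrightarrow> r (X \<union> Y) + r (X \<inter> Y) \<le> r X + r Y)"

text \<open>
  A real vector of length \<open>T\<close> is a function on the naturals of which only the values at
  the indices from 1 to \<open>T\<close> matter; other coordinates are left unconstrained.
\<close>

definition base_polyhedron :: "nat \<Rightarrow> (nat set \<Rightarrow> real) \<Rightarrow> (nat \<Rightarrow> real) set" where
  "base_polyhedron T r =
     {x. (\<forall>X. X \<subset> {1..T} \<longrightarrow> (\<Sum>t\<in>X. x t) \<le> r X) \<and> (\<Sum>t\<in>{1..T}. x t) = r {1..T}}"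

definition stage_set :: "nat \<Rightarrow> (nat set \<Rightarrow> real) \<Rightarrow> nat \<Rightarrow> real set" where
  "stage_set T r t = {r {1..T} - r ({1..T} - {t}) .. r {t}}"

definition strictly_convex_on :: "real set \<Rightarrow> (real \<Rightarrow> real) \<Rightarrow> bool" where
  "strictly_convex_on S g \<longleftrightarrow> convex S \<and>
     (\<forall>x\<in>S. \<forall>y\<in>S. \<forall>u>0. \<forall>v>0. x \<noteq> y \<longrightarrow> u + v = 1 \<longrightarrow>
        g (u * x + v * y) < u * g x + v * g y)"

text \<open>
  The derivative relative to \<open>S\<close>, hence one-sided at endpoints of \<open>S\<close>; it is
  well defined at the points of a nondegenerate interval \<open>S\<close>.
\<close>

definition deriv_on :: "real set \<Rightarrow> (real \<Rightarrow> real) \<Rightarrow> real \<Rightarrow> real" where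
  "deriv_on S g x = vector_derivative g (at x within S)"

definition continuously_differentiable_on :: "(real \<Rightarrow> real) \<Rightarrow> real set \<Rightarrow> bool" where
  "continuously_differentiable_on g S \<longleftrightarrow> g differentiable_on S \<and> continuous_on S (deriv_on S g)"

definition I_sub ::
    "nat \<Rightarrow> (nat set \<Rightarrow> real) \<Rightarrow> (nat \<Rightarrow> real set) \<Rightarrow> (nat \<Rightarrow> real \<Rightarrow> real) \<Rightarrow> bool" where
  "I_sub T r D f \<longleftrightarrow>
     1 \<le> T \<and> submodular_on {1..T} r \<and> r {} = 0 \<and>
     (\<forall>t\<in>{1..T}.
        is_interval (D t) \<and> interior (D t) \<noteq> {} \<and> stage_set T r t \<subseteq> D t \<and>
        mono_on (D t) (f t) \<and> strictly_convex_on (D t) (f t) \<and>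
        continuously_differentiable_on (f t) (D t))"

definition optimal_solution ::
    "nat \<Rightarrow> (nat set \<Rightarrow> real) \<Rightarrow> (nat \<Rightarrow> real \<Rightarrow> real) \<Rightarrow> (nat \<Rightarrow> real) \<Rightarrow> bool" where
  "optimal_solution T r f x \<longleftrightarrow>
     is_arg_min (\<lambda>x. \<Sum>t\<in>{1..T}. f t (x t)) (\<lambda>x. x \<in> base_polyhedron T r) x"

text \<open>
  Multipliers are a pair of \<open>\<mu> :: nat set \<Rightarrow> real\<close>, relevant only on
  \<open>multiplier_index T\<close>, and a scalar \<open>\<lambda>\<close>, written \<open>l\<close>. Neither carries a sign condition.
\<close>

definition multiplier_index :: "nat \<Rightarrow> nat set set" where
  "multiplier_index T = {X. X \<subseteq> {1..T} \<and> 1 < card X \<and> card X < T}"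

definition multiplier_le ::
    "nat \<Rightarrow> (nat set \<Rightarrow> real) \<times> real \<Rightarrow> (nat set \<Rightarrow> real) \<times> real \<Rightarrow> bool" where
  "multiplier_le T p q \<longleftrightarrow> (\<forall>X\<in>multiplier_index T. fst p X \<le> fst q X) \<and> snd p \<le> snd q"

definition nu :: "nat \<Rightarrow> (nat set \<Rightarrow> real) \<Rightarrow> real \<Rightarrow> nat \<Rightarrow> real" where
  "nu T \<mu> l t = - (\<Sum>X\<in>{X \<in> multiplier_index T. t \<in> X}. \<mu> X) - l"

definition local_lagrangian ::
    "nat \<Rightarrow> (nat \<Rightarrow> real \<Rightarrow> real) \<Rightarrow> (nat set \<Rightarrow> real) \<Rightarrow> real \<Rightarrow> nat \<Rightarrow> real \<Rightarrow> real" where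
  "local_lagrangian T f \<mu> l t y = f t y - nu T \<mu> l t * y"

definition the_minimizer :: "(real \<Rightarrow> real) \<Rightarrow> real set \<Rightarrow> real" where
  "the_minimizer g S = (THE y. is_arg_min g (\<lambda>y. y \<in> S) y)"

definition local_solution ::
    "nat \<Rightarrow> (nat set \<Rightarrow> real) \<Rightarrow> (nat \<Rightarrow> real \<Rightarrow> real) \<Rightarrow> (nat set \<Rightarrow> real) \<Rightarrow> real \<Rightarrow> nat \<Rightarrow> real" where
  "local_solution T r f \<mu> l t = the_minimizer (local_lagrangian T f \<mu> l t) (stage_set T r t)"

definition optimal_multipliers ::
    "nat \<Rightarrow> (nat set \<Rightarrow> real) \<Rightarrow> (nat \<Rightarrow> real \<Rightarrow> real) \<Rightarrow> (nat set \<Rightarrow> real) \<Rightarrow> real \<Rightarrow> bool" where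
  "optimal_multipliers T r f \<mu> l \<longleftrightarrow> optimal_solution T r f (local_solution T r f \<mu> l)"

text \<open>
  The set over which stage \<open>t\<close> minimizes consists of the \<open>t\<close>-th coordinates of those
  base vectors whose first \<open>t - 1\<close> coordinates agree with the earlier online decisions.
\<close>

function online_solution ::
    "nat \<Rightarrow> (nat set \<Rightarrow> real) \<Rightarrow> (nat \<Rightarrow> real \<Rightarrow> real) \<Rightarrow> (nat set \<Rightarrow> real) \<Rightarrow> real \<Rightarrow> nat \<Rightarrow> real" where
  "online_solution T r f \<mu> l t =
     the_minimizer (local_lagrangian T f \<mu> l t)
       {y. \<exists>x\<in>base_polyhedron T r. (\<forall>s\<in>{1..<t}. x s = online_solution T r f \<mu> l s) \<and> x t = y}"
  by pat_completeness auto
termination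
  by (relation "Wellfounded.measure (\<lambda>(T, r, f, \<mu>, l, t). t)") auto

text \<open>Not a default rewrite rule, since unfolding it does not terminate.\<close>
declare online_solution.simps [simp del]

definition deriv_inv :: "real set \<Rightarrow> (real \<Rightarrow> real) \<Rightarrow> real \<Rightarrow> real" where
  "deriv_inv S g = inv_into S (deriv_on S g)"

end

theory Submission
  imports Defs
begin

text \<open>
  Since \<open>f\<^sup>t = a\<^sup>t \<nabla>f\<^sup>t\<close>, both claims concern the marginal costs \<open>\<nabla>f\<^sup>t\<close>. The inequality holds
  stage by stage: with \<open>x\<close> the online solution for \<open>(\<mu>hat, lhat)\<close> and \<open>z\<close> the optimal one,
  \<open>\<nabla>f\<^sup>t(x\<^sup>t) - \<nu>hat\<^sup>t \<le> \<nabla>f\<^sup>t(z\<^sup>t) - \<nu>opt\<^sup>t\<close>. This is first-order optimality unless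
  \<open>z\<^sup>t < x\<^sup>t\<close> and \<open>\<nu>hat\<^sup>t < \<nabla>f\<^sup>t(x\<^sup>t)\<close>. In that case let \<open>M\<close> be the largest tight set of \<open>x\<close>
  avoiding \<open>t\<close>. Mass can be moved from \<open>t\<close> to any \<open>j\<close> outside \<open>M\<close>, so online optimality forces
  all such \<open>j\<close> to precede \<open>t\<close>. As \<open>x(M) = r(M) \<ge> z(M)\<close>, some such \<open>s\<close> has \<open>x\<^sup>s < z\<^sup>s\<close>, whence
  \<open>\<nabla>f\<^sup>s(x\<^sup>s) < \<nu>hat\<^sup>s\<close>, and mass cannot be moved from \<open>t\<close> to the earlier \<open>s\<close>: a tight set
  contains \<open>s\<close> but not \<open>t\<close>, contradicting the choice of \<open>M\<close>.
\<close>

subsection \<open>Base polyhedra\<close>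

lemma base_polyhedron_sum_le:
  assumes "x \<in> base_polyhedron T r" "X \<subseteq> {1..T}"
  shows "sum x X \<le> r X"
  using assms unfolding base_polyhedron_def by (cases "X = {1..T}") auto

lemma base_polyhedron_sum_eq: "x \<in> base_polyhedron T r \<Longrightarrow> sum x {1..T} = r {1..T}"
  unfolding base_polyhedron_def by auto

lemma base_polyhedronI:
  assumes "\<And>X. X \<subseteq> {1..T} \<Longrightarrow> sum x X \<le> r X" "sum x {1..T} = r {1..T}"
  shows "x \<in> base_polyhedron T r"
  using assms unfolding base_polyhedron_def by auto

lemma base_polyhedron_cong:
  assumes "x \<in> base_polyhedron T r" "\<And>t. t \<in> {1..T} \<Longrightarrow> x t = y t"
  shows "y \<in> base_polyhedron T r"
proof (rule base_polyhedronI)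
  have eq: "sum y X = sum x X" if "X \<subseteq> {1..T}" for X
    using assms(2) that by (intro sum.cong) auto
  show "sum y X \<le> r X" if "X \<subseteq> {1..T}" for X
    using base_polyhedron_sum_le[OF assms(1) that] eq[OF that] by simp
  show "sum y {1..T} = r {1..T}"
    using base_polyhedron_sum_eq[OF assms(1)] eq by simp
qed

text \<open>The lower end comes from subtracting the constraint of the complement
  \<open>{1..T} - {t}\<close> from the total.\<close>

lemma base_polyhedron_stage_set:
  assumes "x \<in> base_polyhedron T r" "t \<in> {1..T}"
  shows "x t \<in> stage_set T r t"
proof -
  have "sum x {1..T} = x t + sum x ({1..T} - {t})"
    using assms(2) by (simp add: sum.remove)
  moreover have "sum x {t} \<le> r {t}" "sum x ({1..T} - {t}) \<le> r ({1..T} - {t})"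
    using assms by (intro base_polyhedron_sum_le; auto)+
  ultimately show ?thesis
    using base_polyhedron_sum_eq[OF assms(1)] unfolding stage_set_def by auto
qed

lemma base_polyhedron_convex_combination:
  assumes "x \<in> base_polyhedron T r" "y \<in> base_polyhedron T r"
    and "u \<ge> 0" "v \<ge> 0" "u + v = 1"
  shows "(\<lambda>i. u * x i + v * y i) \<in> base_polyhedron T r"
proof (rule base_polyhedronI)
  have eq: "(\<Sum>i\<in>X. u * x i + v * y i) = u * sum x X + v * sum y X" for X
    by (simp add: sum.distrib sum_distrib_left)
  show "(\<Sum>i\<in>X. u * x i + v * y i) \<le> r X" if "X \<subseteq> {1..T}" for X
    unfolding eq using assms that
    by (intro convex_bound_le base_polyhedron_sum_le) auto
  show "(\<Sum>i\<in>{1..T}. u * x i + v * y i) = r {1..T}"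
    unfolding eq base_polyhedron_sum_eq[OF assms(1)] base_polyhedron_sum_eq[OF assms(2)]
    using assms(5) by (metis distrib_right mult_1)
qed

text \<open>Coordinates outside \<open>{1..T}\<close> must be pinned, since the polyhedron leaves them free.\<close>

lemma compact_base_polyhedron_pinned:
  "compact {x \<in> base_polyhedron T r. \<forall>i. i \<notin> {1..T} \<longrightarrow> x i = 0}" (is "compact ?P")
proof -
  \<comment> \<open>The pinned polyhedron is cut out by closed conditions from a product of compact
    sets, which is compact by Tychonoff.\<close>
  define C where "C i = (if i \<in> {1..T} then stage_set T r i else {0})" for i
  have "compactin (product_topology (\<lambda>i::nat. euclidean) UNIV) (PiE UNIV C)"
    unfolding compactin_PiE by (auto simp: C_def stage_set_def)
  then have "compact (PiE UNIV C)"
    unfolding euclidean_product_topology by simp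
  moreover have cont: "continuous_on UNIV (\<lambda>x::nat \<Rightarrow> real. sum x X)" for X
    by (intro continuous_on_sum continuous_on_product_coordinates)
  have "closed (\<Inter>X\<in>Pow {1..T}. {x::nat \<Rightarrow> real. sum x X \<le> r X})"
    by (intro closed_INT ballI closed_Collect_le cont continuous_on_const)
  moreover have "closed {x::nat \<Rightarrow> real. sum x {1..T} = r {1..T}}"
    by (intro closed_Collect_eq cont continuous_on_const)
  ultimately have "compact (PiE UNIV C \<inter> ((\<Inter>X\<in>Pow {1..T}. {x. sum x X \<le> r X})
      \<inter> {x. sum x {1..T} = r {1..T}}))"
    by (intro compact_Int_closed closed_Int)
  moreover have "?P = PiE UNIV C \<inter> ((\<Inter>X\<in>Pow {1..T}. {x. sum x X \<le> r X})
      \<inter> {x. sum x {1..T} = r {1..T}})"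
  proof (intro equalityI subsetI)
    fix x assume "x \<in> ?P"
    then show "x \<in> PiE UNIV C \<inter> ((\<Inter>X\<in>Pow {1..T}. {x. sum x X \<le> r X})
      \<inter> {x. sum x {1..T} = r {1..T}})"
      using base_polyhedron_sum_le[of x T r] base_polyhedron_sum_eq[of x T r]
        base_polyhedron_stage_set[of x T r] by (auto simp: C_def PiE_iff)
  next
    fix x assume x: "x \<in> PiE UNIV C \<inter> ((\<Inter>X\<in>Pow {1..T}. {x. sum x X \<le> r X})
      \<inter> {x. sum x {1..T} = r {1..T}})"
    then have "x \<in> base_polyhedron T r"
      by (intro base_polyhedronI) auto
    moreover have "x i = 0" if "i \<notin> {1..T}" for i
    proof -
      have "x i \<in> C i" using x by (auto simp: PiE_iff)
      with that show ?thesis by (auto simp: C_def split: if_splits)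
    qed
    ultimately show "x \<in> ?P" by auto
  qed
  ultimately show ?thesis by simp
qed

section \<open>Tight sets and exchange of mass\<close>

text \<open>Uncrossing: submodularity leaves no total slack for the constraints of the union and the
  intersection, so neither has any.\<close>

lemma tight_Un:
  assumes "submodular_on {1..T} r" "x \<in> base_polyhedron T r"
    and "X \<subseteq> {1..T}" "Y \<subseteq> {1..T}" "sum x X = r X" "sum x Y = r Y"
  shows "sum x (X \<union> Y) = r (X \<union> Y)"
proof -
  have fin: "finite X" "finite Y"
    using assms(3,4) by (auto intro: finite_subset)
  have "sum x (X \<union> Y) + sum x (X \<inter> Y) = r X + r Y"
    using sum.union_inter[OF fin, of x] assms(5,6) by simp
  moreover have "r (X \<union> Y) + r (X \<inter> Y) \<le> r X + r Y"
    using assms(1,3,4) unfolding submodular_on_def by auto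
  moreover have "sum x (X \<union> Y) \<le> r (X \<union> Y)" "sum x (X \<inter> Y) \<le> r (X \<inter> Y)"
    using assms(2-4) by (auto intro!: base_polyhedron_sum_le)
  ultimately show ?thesis by linarith
qed

text \<open>This provides a largest tight set avoiding a given index, namely the union of all of
  them. The empty family is tight because \<open>r {} = 0\<close>.\<close>

lemma tight_Union:
  assumes "submodular_on {1..T} r" "r {} = 0" "x \<in> base_polyhedron T r"
    and "finite \<F>" "\<And>X. X \<in> \<F> \<Longrightarrow> X \<subseteq> {1..T} \<and> sum x X = r X"
  shows "sum x (\<Union>\<F>) = r (\<Union>\<F>)"
  using assms(4,5)
proof (induction \<F>)
  case empty
  then show ?case using assms(2) by simp
next
  case (insert X \<F>)
  then have "sum x (X \<union> \<Union>\<F>) = r (X \<union> \<Union>\<F>)"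
    by (intro tight_Un[OF assms(1,3)]) auto
  then show ?case by simp
qed

text \<open>Moving mass from \<open>j\<close> to \<open>i\<close> raises the sum only of sets that
  contain \<open>i\<close> but not \<open>j\<close>. None of these is tight and there are finitely
  many, so their least slack is a positive admissible step.\<close>

lemma base_polyhedron_exchange:
  assumes x: "x \<in> base_polyhedron T r" and ij: "i \<in> {1..T}" "j \<in> {1..T}" "i \<noteq> j"
    and tight: "\<And>X. X \<subseteq> {1..T} \<Longrightarrow> sum x X = r X \<Longrightarrow> i \<in> X \<Longrightarrow> j \<in> X"
  shows "\<exists>e>0. \<forall>d\<in>{0..e}. x(i := x i + d, j := x j - d) \<in> base_polyhedron T r"
proof -
  define \<F> where "\<F> = {X. X \<subseteq> {1..T} \<and> i \<in> X \<and> j \<notin> X}"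
  define e where "e = Min ((\<lambda>X. r X - sum x X) ` \<F>)"
  have fin: "finite \<F>" by (auto simp: \<F>_def)
  \<comment> \<open>Nonemptiness of the family makes the \<open>Min\<close> defining
    \<open>e\<close> meaningful.\<close>
  have "{i} \<in> \<F>" using ij by (auto simp: \<F>_def)
  then have ne: "\<F> \<noteq> {}" by blast
  have "r X - sum x X > 0" if "X \<in> \<F>" for X
    using base_polyhedron_sum_le[OF x, of X] tight[of X] that by (force simp: \<F>_def)
  then have "e > 0"
    unfolding e_def using fin ne by (subst Min_gr_iff) auto
  moreover have "x(i := x i + d, j := x j - d) \<in> base_polyhedron T r" (is "?y \<in> _")
    if "d \<in> {0..e}" for d
  proof (rule base_polyhedronI)
    have d: "0 \<le> d" "d \<le> e" using that by auto
    have eq: "sum ?y X = sum x X + (if i \<in> X then d else 0) - (if j \<in> X then d else 0)"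
      if "X \<subseteq> {1..T}" for X
    proof -
      have fX: "finite X" using that by (auto intro: finite_subset)
      have "sum ?y X = (\<Sum>k\<in>X. x k + (if k = i then d else 0) - (if k = j then d else 0))"
        using ij(3) by (intro sum.cong) auto
      also have "\<dots> = sum x X + (if i \<in> X then d else 0) - (if j \<in> X then d else 0)"
        using fX by (simp add: sum.distrib sum_subtractf)
      finally show ?thesis .
    qed
    show "sum ?y X \<le> r X" if "X \<subseteq> {1..T}" for X
    proof (cases "X \<in> \<F>")
      case True
      then have "e \<le> r X - sum x X"
        unfolding e_def using fin by (intro Min_le) auto
      with True eq[OF that] d show ?thesis by (simp add: \<F>_def)
    next
      case False
      with eq[OF that] base_polyhedron_sum_le[OF x that] d(1) that show ?thesis
        by (auto simp: \<F>_def split: if_splits)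
    qed
    show "sum ?y {1..T} = r {1..T}"
      using eq[of "{1..T}"] ij base_polyhedron_sum_eq[OF x] by simp
  qed
  ultimately show ?thesis by blast
qed

subsection \<open>Minimizers\<close>

lemma strictly_convex_on_subset:
  assumes "strictly_convex_on S g" "A \<subseteq> S" "convex A"
  shows "strictly_convex_on A g"
  using assms unfolding strictly_convex_on_def by blast

lemma strictly_convex_on_local_lagrangian:
  assumes "strictly_convex_on S (f t)"
  shows "strictly_convex_on S (local_lagrangian T f \<mu> l t)"
  unfolding strictly_convex_on_def
proof (intro conjI ballI allI impI)
  show "convex S" using assms unfolding strictly_convex_on_def by blast
  fix x y u v :: real
  assume h: "x \<in> S" "y \<in> S" "0 < u" "0 < v" "x \<noteq> y" "u + v = 1"
  then have "f t (u * x + v * y) < u * f t x + v * f t y"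
    using assms unfolding strictly_convex_on_def by blast
  then show "local_lagrangian T f \<mu> l t (u * x + v * y)
      < u * local_lagrangian T f \<mu> l t x + v * local_lagrangian T f \<mu> l t y"
    by (simp add: local_lagrangian_def algebra_simps)
qed

text \<open>Two distinct minimizers would both be beaten by their midpoint.\<close>

lemma the_minimizer_eq:
  assumes sc: "strictly_convex_on S g" and y: "is_arg_min g (\<lambda>y. y \<in> S) y"
  shows "the_minimizer g S = y"
  unfolding the_minimizer_def
proof (rule the_equality)
  fix z assume z: "is_arg_min g (\<lambda>y. y \<in> S) z"
  have yS: "y \<in> S" and zS: "z \<in> S" and eq: "g y = g z"
    using y z by (auto simp: is_arg_min_linorder intro: antisym)
  show "z = y"
  proof (rule ccontr)
    assume ne: "z \<noteq> y"
    let ?m = "1/2 * z + 1/2 * y"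
    have "u + v = 1 \<longrightarrow> g (u * z + v * y) < u * g z + v * g y" if "u > 0" "v > 0" for u v
      using sc yS zS ne that unfolding strictly_convex_on_def by blast
    from this[of "1/2" "1/2"] have "g ?m < 1/2 * g z + 1/2 * g y" by simp
    moreover have "convex S" using sc unfolding strictly_convex_on_def by blast
    from convexD[OF this zS yS, of "1/2" "1/2"] have "?m \<in> S" by simp
    ultimately show False
      using y eq by (auto simp: is_arg_min_linorder)
  qed
qed (rule y)

lemma is_arg_min_the_minimizer:
  assumes "strictly_convex_on S g" "compact S" "S \<noteq> {}" "continuous_on S g"
  shows "is_arg_min g (\<lambda>y. y \<in> S) (the_minimizer g S)"
proof -
  obtain y where "y \<in> S" "\<forall>z\<in>S. g y \<le> g z"
    using continuous_attains_inf assms(2-4) by blast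
  then have "is_arg_min g (\<lambda>y. y \<in> S) y" by (auto simp: is_arg_min_linorder)
  with the_minimizer_eq[OF assms(1) this] show ?thesis by simp
qed

section \<open>One-sided first-order conditions\<close>

text \<open>A slope below \<open>c\<close> would make \<open>h x - c * x\<close> drop strictly just
  to the right of \<open>y\<close>. Only one side is tested, since feasibility may allow no
  perturbation to the other.\<close>

lemma deriv_ge_of_right_min:
  fixes h :: "real \<Rightarrow> real"
  assumes "(h has_real_derivative D) (at y)" "e > 0"
    and "\<And>d. 0 \<le> d \<Longrightarrow> d \<le> e \<Longrightarrow> h y - c * y \<le> h (y + d) - c * (y + d)"
  shows "c \<le> D"
proof (rule ccontr)
  assume "\<not> c \<le> D"
  moreover have "((\<lambda>x. h x - c * x) has_real_derivative (D - c)) (at y)"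
    using assms(1) by (auto intro!: derivative_eq_intros)
  ultimately obtain d where d: "d > 0"
    "\<forall>k>0. k < d \<longrightarrow> h (y + k) - c * (y + k) < h y - c * y"
    using DERIV_neg_dec_right[of "\<lambda>x. h x - c * x" "D - c" y] by auto
  define k where "k = min e (d / 2)"
  have "0 < k" "k < d" "k \<le> e" using d(1) assms(2) by (auto simp: k_def)
  with d(2) assms(3)[of k] show False by fastforce
qed

lemma deriv_le_of_left_min:
  fixes h :: "real \<Rightarrow> real"
  assumes "(h has_real_derivative D) (at y)" "e > 0"
    and "\<And>d. 0 \<le> d \<Longrightarrow> d \<le> e \<Longrightarrow> h y - c * y \<le> h (y - d) - c * (y - d)"
  shows "D \<le> c"
proof -
  \<comment> \<open>Reflection turns perturbations to the left into perturbations to the right and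
    negates slopes.\<close>
  have "((\<lambda>x. h (- x)) has_real_derivative (- D)) (at (- y))"
    using assms(1) DERIV_mirror[of h D "- y"] by simp
  then have "- c \<le> - D"
    by (rule deriv_ge_of_right_min[OF _ assms(2)]) (use assms(3) in \<open>simp add: algebra_simps\<close>)
  then show ?thesis by simp
qed

subsection \<open>Online solutions\<close>

text \<open>An arbitrary prefix \<open>p\<close> replaces the earlier decisions, so that convexity
  and compactness can be shown apart from the recursion.\<close>

definition online_feasible ::
    "nat \<Rightarrow> (nat set \<Rightarrow> real) \<Rightarrow> (nat \<Rightarrow> real) \<Rightarrow> nat \<Rightarrow> real set" where
  "online_feasible T r p t =
     {y. \<exists>x\<in>base_polyhedron T r. (\<forall>s\<in>{1..<t}. x s = p s) \<and> x t = y}"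

lemma online_solution_eq:
  "online_solution T r f \<mu> l t =
     the_minimizer (local_lagrangian T f \<mu> l t) (online_feasible T r (online_solution T r f \<mu> l) t)"
  unfolding online_feasible_def by (rule online_solution.simps)

lemma online_feasible_subset:
  "t \<in> {1..T} \<Longrightarrow> online_feasible T r p t \<subseteq> stage_set T r t"
  unfolding online_feasible_def using base_polyhedron_stage_set by blast

lemma convex_online_feasible: "convex (online_feasible T r p t)"
  unfolding convex_def
proof (intro ballI allI impI)
  fix y z u v :: real
  assume yz: "y \<in> online_feasible T r p t" "z \<in> online_feasible T r p t"
    and uv: "0 \<le> u" "0 \<le> v" "u + v = 1"
  obtain x where x: "x \<in> base_polyhedron T r" "\<forall>s\<in>{1..<t}. x s = p s" "x t = y"
    using yz(1) unfolding online_feasible_def by blast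
  obtain x' where x': "x' \<in> base_polyhedron T r" "\<forall>s\<in>{1..<t}. x' s = p s" "x' t = z"
    using yz(2) unfolding online_feasible_def by blast
  let ?w = "\<lambda>i. u * x i + v * x' i"
  have "?w \<in> base_polyhedron T r"
    by (rule base_polyhedron_convex_combination[OF x(1) x'(1) uv])
  moreover have "\<forall>s\<in>{1..<t}. ?w s = p s"
  proof
    fix s assume "s \<in> {1..<t}"
    then have "?w s = (u + v) * p s"
      using x(2) x'(2) by (simp add: distrib_right)
    then show "?w s = p s" by (simp add: uv(3))
  qed
  moreover have "?w t = u *\<^sub>R y + v *\<^sub>R z"
    using x(3) x'(3) by simp
  ultimately show "u *\<^sub>R y + v *\<^sub>R z \<in> online_feasible T r p t"
    unfolding online_feasible_def by (intro CollectI bexI[of _ ?w] conjI)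
qed

text \<open>The set is a coordinate projection of a closed slice of the compact pinned
  polyhedron.\<close>

lemma compact_online_feasible:
  assumes t: "t \<in> {1..T}"
  shows "compact (online_feasible T r p t)"
proof -
  let ?P = "{x \<in> base_polyhedron T r. \<forall>i. i \<notin> {1..T} \<longrightarrow> x i = 0}"
  let ?Q = "?P \<inter> (\<Inter>s\<in>{1..<t}. {x. x s = p s})"
  have "closed (\<Inter>s\<in>{1..<t}. {x::nat \<Rightarrow> real. x s = p s})"
    using closed_Collect_eq[OF continuous_on_product_coordinates continuous_on_const]
    by (intro closed_INT ballI)
  then have "compact ?Q"
    by (intro compact_Int_closed compact_base_polyhedron_pinned)
  moreover have "continuous_on ?Q (\<lambda>x. x t)"
    using continuous_on_product_coordinates by (rule continuous_on_subset) simp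
  ultimately have "compact ((\<lambda>x. x t) ` ?Q)"
    by (intro compact_continuous_image)
  moreover have "online_feasible T r p t = (\<lambda>x. x t) ` ?Q"
  proof (intro equalityI subsetI)
    fix y assume "y \<in> online_feasible T r p t"
    then obtain x where x: "x \<in> base_polyhedron T r" "\<forall>s\<in>{1..<t}. x s = p s" "x t = y"
      unfolding online_feasible_def by blast
    \<comment> \<open>Zeroing the free coordinates pins the witness; the prefix and coordinate
      \<open>t\<close> lie inside \<open>{1..T}\<close> and keep their values.\<close>
    let ?x = "\<lambda>i. if i \<in> {1..T} then x i else 0"
    have "?x \<in> base_polyhedron T r"
      by (rule base_polyhedron_cong[OF x(1)]) auto
    then have "?x \<in> ?Q" using x(2) t by auto
    from imageI[OF this, of "\<lambda>x. x t"] show "y \<in> (\<lambda>x. x t) ` ?Q"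
      using x(3) t by simp
  next
    fix y assume "y \<in> (\<lambda>x. x t) ` ?Q"
    then obtain x where "x \<in> ?Q" "y = x t" by (rule imageE)
    then show "y \<in> online_feasible T r p t"
      unfolding online_feasible_def by auto
  qed
  ultimately show ?thesis by simp
qed

context
  fixes T :: nat and r :: "nat set \<Rightarrow> real" and f :: "nat \<Rightarrow> real \<Rightarrow> real"
  assumes cont: "\<And>t. t \<in> {1..T} \<Longrightarrow> continuous_on (stage_set T r t) (f t)"
    and sconv: "\<And>t. t \<in> {1..T} \<Longrightarrow> strictly_convex_on (stage_set T r t) (f t)"
begin

text \<open>Nonemptiness stays a hypothesis because it requires the earlier decisions to be jointly
  extendable; \<open>online_prefix_extends\<close> establishes that by an induction which uses this
  lemma.\<close>

lemma online_solution_arg_min_if_nonempty: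
  assumes t: "t \<in> {1..T}"
    and ne: "online_feasible T r (online_solution T r f \<mu> l) t \<noteq> {}" (is "?S \<noteq> {}")
  shows "is_arg_min (local_lagrangian T f \<mu> l t) (\<lambda>y. y \<in> ?S) (online_solution T r f \<mu> l t)"
  unfolding online_solution_eq[of T r f \<mu> l t]
proof (rule is_arg_min_the_minimizer)
  show "strictly_convex_on ?S (local_lagrangian T f \<mu> l t)"
    by (intro strictly_convex_on_local_lagrangian
        strictly_convex_on_subset[OF sconv[OF t] online_feasible_subset[OF t]]
        convex_online_feasible)
  show "compact ?S" by (rule compact_online_feasible[OF t])
  show "?S \<noteq> {}" by (rule ne)
  have "continuous_on ?S (f t)"
    by (rule continuous_on_subset[OF cont[OF t] online_feasible_subset[OF t]])
  then show "continuous_on ?S (local_lagrangian T f \<mu> l t)"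
    unfolding local_lagrangian_def[abs_def] by (intro continuous_intros)
qed

text \<open>A base vector extending the first \<open>n\<close> decisions shows that stage
  \<open>Suc n\<close> has a feasible value. Its minimizer then exists and is feasible, and
  feasibility supplies the next base vector.\<close>

lemma online_prefix_extends:
  assumes ne: "base_polyhedron T r \<noteq> {}" and "n \<le> T"
  shows "\<exists>x\<in>base_polyhedron T r. \<forall>s\<in>{1..n}. x s = online_solution T r f \<mu> l s"
  using \<open>n \<le> T\<close>
proof (induction n)
  case 0
  then show ?case using ne by auto
next
  case (Suc n)
  let ?S = "online_feasible T r (online_solution T r f \<mu> l) (Suc n)"
  obtain x where "x \<in> base_polyhedron T r" "\<forall>s\<in>{1..n}. x s = online_solution T r f \<mu> l s"
    using Suc by auto
  then have "x (Suc n) \<in> ?S"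
    unfolding online_feasible_def by (auto intro!: bexI[of _ x])
  then have "online_solution T r f \<mu> l (Suc n) \<in> ?S"
    using online_solution_arg_min_if_nonempty[of "Suc n" \<mu> l] Suc.prems
    by (auto simp: is_arg_min_def)
  then obtain x' where "x' \<in> base_polyhedron T r"
    "\<forall>s\<in>{1..<Suc n}. x' s = online_solution T r f \<mu> l s"
    "x' (Suc n) = online_solution T r f \<mu> l (Suc n)"
    unfolding online_feasible_def by blast
  then show ?case
    by (intro bexI[of _ x']) (auto simp: le_Suc_eq)
qed

lemma online_solution_mem:
  assumes "base_polyhedron T r \<noteq> {}"
  shows "online_solution T r f \<mu> l \<in> base_polyhedron T r"
  using online_prefix_extends[OF assms order_refl, of \<mu> l] base_polyhedron_cong by blast

lemma online_solution_le:
  assumes t: "t \<in> {1..T}" and x: "x \<in> base_polyhedron T r"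
    and prefix: "\<And>s. s \<in> {1..<t} \<Longrightarrow> x s = online_solution T r f \<mu> l s"
  shows "local_lagrangian T f \<mu> l t (online_solution T r f \<mu> l t) \<le> local_lagrangian T f \<mu> l t (x t)"
proof -
  have "x t \<in> online_feasible T r (online_solution T r f \<mu> l) t"
    unfolding online_feasible_def using x prefix by blast
  with online_solution_arg_min_if_nonempty[OF t, of \<mu> l] show ?thesis
    by (auto simp: is_arg_min_linorder)
qed

lemma local_solution_arg_min:
  assumes t: "t \<in> {1..T}" and ne: "stage_set T r t \<noteq> {}"
  shows "is_arg_min (local_lagrangian T f \<mu> l t) (\<lambda>y. y \<in> stage_set T r t)
    (local_solution T r f \<mu> l t)"
  unfolding local_solution_def
proof (rule is_arg_min_the_minimizer)
  show "strictly_convex_on (stage_set T r t) (local_lagrangian T f \<mu> l t)"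
    by (intro strictly_convex_on_local_lagrangian sconv t)
  show "compact (stage_set T r t)" by (simp add: stage_set_def)
  show "continuous_on (stage_set T r t) (local_lagrangian T f \<mu> l t)"
    unfolding local_lagrangian_def[abs_def] by (intro continuous_intros cont t)
qed (rule ne)

text \<open>By induction the earlier online decisions are the local ones, so the local solution
  itself witnesses that its \<open>t\<close>-th coordinate is feasible. A minimizer over the stage
  set that lies in the smaller feasible set also minimizes there, and strict convexity makes it
  unique.\<close>

lemma online_solution_eq_local_solution:
  assumes mem: "local_solution T r f \<mu> l \<in> base_polyhedron T r" and "t \<in> {1..T}"
  shows "online_solution T r f \<mu> l t = local_solution T r f \<mu> l t"
  using \<open>t \<in> {1..T}\<close>
proof (induction t rule: less_induct)
  case (less t)
  let ?S = "online_feasible T r (online_solution T r f \<mu> l) t"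
  have "local_solution T r f \<mu> l t \<in> ?S"
    unfolding online_feasible_def using mem less by fastforce
  moreover have "is_arg_min (local_lagrangian T f \<mu> l t) (\<lambda>y. y \<in> stage_set T r t)
      (local_solution T r f \<mu> l t)"
    using base_polyhedron_stage_set[OF mem less.prems] less.prems
    by (intro local_solution_arg_min) auto
  ultimately have "is_arg_min (local_lagrangian T f \<mu> l t) (\<lambda>y. y \<in> ?S)
      (local_solution T r f \<mu> l t)"
    using online_feasible_subset[OF less.prems] by (auto simp: is_arg_min_linorder)
  then show ?case
    by (subst online_solution_eq, intro the_minimizer_eq strictly_convex_on_local_lagrangian
        strictly_convex_on_subset[OF sconv[OF less.prems] online_feasible_subset[OF less.prems]]
        convex_online_feasible)
qed

end

subsection \<open>Comparison of marginal costs\<close>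

text \<open>
  The derivatives \<open>g\<close> are two-sided derivatives of extensions \<open>h\<close> of the stage costs, so that
  endpoints of the stage sets need no special treatment.
\<close>

lemma online_marginal_le:
  fixes h g :: "nat \<Rightarrow> real \<Rightarrow> real"
  assumes sub: "submodular_on {1..T} r" and r0: "r {} = 0"
    and cont: "\<And>t. t \<in> {1..T} \<Longrightarrow> continuous_on (stage_set T r t) (f t)"
    and sconv: "\<And>t. t \<in> {1..T} \<Longrightarrow> strictly_convex_on (stage_set T r t) (f t)"
    and fh: "\<And>t y. t \<in> {1..T} \<Longrightarrow> y \<in> stage_set T r t \<Longrightarrow> f t y = h t y"
    and deriv: "\<And>t y. t \<in> {1..T} \<Longrightarrow> (h t has_real_derivative g t y) (at y)"
    and g_mono: "\<And>t. t \<in> {1..T} \<Longrightarrow> strict_mono (g t)"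
    and z_mem: "local_solution T r f \<mu>' l' \<in> base_polyhedron T r"
    and nu_le: "\<And>t. t \<in> {1..T} \<Longrightarrow> nu T \<mu>' l' t \<le> nu T \<mu> l t"
    and t: "t \<in> {1..T}"
  shows "g t (online_solution T r f \<mu> l t) - nu T \<mu> l t
    \<le> g t (local_solution T r f \<mu>' l' t) - nu T \<mu>' l' t"
proof -
  define x where "x = online_solution T r f \<mu> l"
  define z where "z = local_solution T r f \<mu>' l'"
  have zB: "z \<in> base_polyhedron T r" using z_mem by (simp add: z_def)
  have xB: "x \<in> base_polyhedron T r"
    unfolding x_def using online_solution_mem[OF cont sconv] zB by blast
  have xC: "x i \<in> stage_set T r i" and zC: "z i \<in> stage_set T r i" if "i \<in> {1..T}" for i
    using xB zB that by (auto intro: base_polyhedron_stage_set)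
  have z_min: "h i (z i) - nu T \<mu>' l' i * z i \<le> h i y - nu T \<mu>' l' i * y"
    if "i \<in> {1..T}" "y \<in> stage_set T r i" for i y
    using local_solution_arg_min[OF cont sconv, of i \<mu>' l'] that zC[of i]
    by (auto simp: is_arg_min_linorder z_def local_lagrangian_def fh)
  have x_min: "h i (x i) - nu T \<mu> l i * x i \<le> h i (y i) - nu T \<mu> l i * y i"
    if "i \<in> {1..T}" "y \<in> base_polyhedron T r" "\<And>s. s \<in> {1..<i} \<Longrightarrow> y s = x s" for i y
    using online_solution_le[OF cont sconv, of i y \<mu> l] that xC[of i]
      base_polyhedron_stage_set[of y T r i]
    by (auto simp: x_def local_lagrangian_def fh)
  \<comment> \<open>The local solution competes with the whole stage set, which contains the segment
    from \<open>z i\<close> to \<open>x i\<close>; hence the step length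
    \<open>x i - z i\<close>.\<close>
  have z_ge: "nu T \<mu>' l' i \<le> g i (z i)" if "i \<in> {1..T}" "z i < x i" for i
    by (rule deriv_ge_of_right_min[OF deriv, where e = "x i - z i"])
      (use that zC[of i] xC[of i] in \<open>auto intro!: z_min simp: stage_set_def\<close>)
  have z_le: "g i (z i) \<le> nu T \<mu>' l' i" if "i \<in> {1..T}" "x i < z i" for i
    by (rule deriv_le_of_left_min[OF deriv, where e = "z i - x i"])
      (use that zC[of i] xC[of i] in \<open>auto intro!: z_min simp: stage_set_def\<close>)
  \<comment> \<open>Stage \<open>i\<close> would gain from a larger value. Taking mass from a later
    \<open>j\<close> leaves the decisions before \<open>i\<close> intact, so a tight set must block
    the exchange.\<close>
  have raise: "\<exists>X\<subseteq>{1..T}. sum x X = r X \<and> i \<in> X \<and> j \<notin> X"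
    if i: "i \<in> {1..T}" and j: "j \<in> {1..T}" and ij: "i < j" and strict: "g i (x i) < nu T \<mu> l i" for i j
  proof (rule ccontr)
    assume "\<not> ?thesis"
    then have dep: "\<And>X. X \<subseteq> {1..T} \<Longrightarrow> sum x X = r X \<Longrightarrow> i \<in> X \<Longrightarrow> j \<in> X"
      by blast
    have ne: "i \<noteq> j" using ij by simp
    obtain e where e: "e > 0"
      "\<forall>d\<in>{0..e}. x(i := x i + d, j := x j - d) \<in> base_polyhedron T r"
      using base_polyhedron_exchange[OF xB i j ne dep] by blast
    have "nu T \<mu> l i \<le> g i (x i)"
    proof (rule deriv_ge_of_right_min[OF deriv[OF i] e(1)])
      fix d :: real assume "0 \<le> d" "d \<le> e"
      then have "d \<in> {0..e}" by simp
      from x_min[OF i bspec[OF e(2) this]] ij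
      show "h i (x i) - nu T \<mu> l i * x i \<le> h i (x i + d) - nu T \<mu> l i * (x i + d)" by simp
    qed
    with strict show False by simp
  qed
  \<comment> \<open>The mirror case: stage \<open>i\<close> would gain by handing mass to a later
    \<open>j\<close>.\<close>
  have lower: "\<exists>X\<subseteq>{1..T}. sum x X = r X \<and> j \<in> X \<and> i \<notin> X"
    if i: "i \<in> {1..T}" and j: "j \<in> {1..T}" and ij: "i < j" and strict: "nu T \<mu> l i < g i (x i)" for i j
  proof (rule ccontr)
    assume "\<not> ?thesis"
    then have dep: "\<And>X. X \<subseteq> {1..T} \<Longrightarrow> sum x X = r X \<Longrightarrow> j \<in> X \<Longrightarrow> i \<in> X"
      by blast
    have ne: "j \<noteq> i" using ij by simp
    obtain e where e: "e > 0"
      "\<forall>d\<in>{0..e}. x(j := x j + d, i := x i - d) \<in> base_polyhedron T r"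
      using base_polyhedron_exchange[OF xB j i ne dep] by blast
    have "g i (x i) \<le> nu T \<mu> l i"
    proof (rule deriv_le_of_left_min[OF deriv[OF i] e(1)])
      fix d :: real assume "0 \<le> d" "d \<le> e"
      then have "d \<in> {0..e}" by simp
      from x_min[OF i bspec[OF e(2) this]] ij
      show "h i (x i) - nu T \<mu> l i * x i \<le> h i (x i - d) - nu T \<mu> l i * (x i - d)" by simp
    qed
    with strict show False by simp
  qed
  have "g t (x t) - nu T \<mu> l t \<le> g t (z t) - nu T \<mu>' l' t"
  proof (cases "x t \<le> z t")
    case True
    then have "g t (x t) \<le> g t (z t)"
      using g_mono[OF t] by (simp add: strict_mono_less_eq)
    with nu_le[OF t] show ?thesis by simp
  next
    case False
    then have zx: "z t < x t" by simp
    \<comment> \<open>Together with \<open>z_ge\<close> this puts 0 between the two sides of the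
      claim.\<close>
    have "g t (x t) \<le> nu T \<mu> l t"
    proof (rule ccontr)
      assume "\<not> ?thesis"
      then have gt: "nu T \<mu> l t < g t (x t)" by simp
      define \<F> where "\<F> = {X. X \<subseteq> {1..T} \<and> sum x X = r X \<and> t \<notin> X}"
      define M where "M = \<Union>\<F>"
      have M: "M \<subseteq> {1..T}" "t \<notin> M" by (auto simp: M_def \<F>_def)
      have fin: "finite \<F>" by (auto simp: \<F>_def)
      have "sum x M = r M"
        unfolding M_def by (rule tight_Union[OF sub r0 xB fin]) (auto simp: \<F>_def)
      then have le: "sum z M \<le> sum x M"
        using base_polyhedron_sum_le[OF zB M(1)] by simp
      have eq: "sum z {1..T} = sum x {1..T}"
        using base_polyhedron_sum_eq[OF zB] base_polyhedron_sum_eq[OF xB] by simp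
      have split: "sum y {1..T} = sum y M + (y t + sum y ({1..T} - M - {t}))"
        for y :: "nat \<Rightarrow> real"
        using sum.subset_diff[OF M(1), of y] sum.remove[of "{1..T} - M" t y] M(2) t by simp
      \<comment> \<open>On \<open>M\<close> the sum of \<open>z\<close> is at most that of
        \<open>x\<close>, and at \<open>t\<close> it is strictly less, yet the totals agree; the
        remaining indices must compensate.\<close>
      have "\<not> sum z ({1..T} - M - {t}) \<le> sum x ({1..T} - M - {t})"
        using le eq zx split[of x] split[of z] by linarith
      then have "\<not> (\<forall>s\<in>{1..T} - M - {t}. z s \<le> x s)"
        by (meson sum_mono)
      then obtain s where "s \<in> {1..T} - M - {t}" "x s < z s"
        by (meson not_le)
      then have s: "s \<in> {1..T}" "s \<notin> M" "s \<noteq> t" "x s < z s"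
        by auto
      \<comment> \<open>If \<open>t\<close> came first, \<open>lower\<close> would give a tight set
        with \<open>s\<close> but without \<open>t\<close>, which lies in \<open>M\<close>.\<close>
      have "s < t"
      proof (rule ccontr)
        assume "\<not> s < t"
        with s(3) have "t < s" by simp
        from lower[OF t s(1) this gt] s(2) show False
          by (auto simp: M_def \<F>_def)
      qed
      have "g s (x s) < g s (z s)"
        using g_mono[OF s(1)] s(4) by (simp add: strict_mono_less)
      \<comment> \<open>Here \<open>z_le\<close> bounds the marginal cost at \<open>z s\<close> by
        the second multipliers, whose \<open>nu\<close> is the smaller one. Thus
        \<open>raise\<close> applies to \<open>s\<close> before \<open>t\<close> and again puts
        \<open>s\<close> into \<open>M\<close>.\<close>
      then have "g s (x s) < nu T \<mu> l s"
        using z_le[OF s(1,4)] nu_le[OF s(1)] by simp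
      from raise[OF s(1) t \<open>s < t\<close> this] s(2) show False
        by (auto simp: M_def \<F>_def)
    qed
    with z_ge[OF t zx] show ?thesis by simp
  qed
  then show ?thesis by (simp add: x_def z_def)
qed

lemma nu_antimono:
  assumes "multiplier_le T (\<mu>, l) (\<mu>', l')"
  shows "nu T \<mu>' l' t \<le> nu T \<mu> l t"
proof -
  have "(\<Sum>X\<in>{X \<in> multiplier_index T. t \<in> X}. \<mu> X) \<le> (\<Sum>X\<in>{X \<in> multiplier_index T. t \<in> X}. \<mu>' X)"
    using assms by (intro sum_mono) (auto simp: multiplier_le_def)
  with assms show ?thesis by (auto simp: nu_def multiplier_le_def)
qed

section \<open>Relative derivatives and the exponential costs\<close>

text \<open>Every point of a nondegenerate interval is a limit point of it, so the derivative within
  \<open>S\<close> is unique and can be read off from any differentiable extension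
  \<open>h\<close>.\<close>

lemma deriv_on_eq:
  assumes S: "is_interval S" "interior S \<noteq> {}" and x: "x \<in> S"
    and eq: "\<And>y. y \<in> S \<Longrightarrow> g y = h y" and h: "(h has_real_derivative d) (at x)"
  shows "deriv_on S g x = d"
proof -
  have "S \<noteq> {x}" using S(2) by auto
  then have "x islimpt S"
    using S(1) x by (intro connected_imp_perfect) (auto simp: is_interval_connected)
  moreover have "(g has_vector_derivative d) (at x within S)"
  proof (rule has_vector_derivative_transform[OF x])
    show "(h has_vector_derivative d) (at x within S)"
      using h by (simp add: has_real_derivative_iff_has_vector_derivative
          has_vector_derivative_at_within)
  qed (rule eq)
  ultimately show ?thesis
    unfolding deriv_on_def by (intro vector_derivative_within) (auto simp: trivial_limit_within)
qed

theorem corollary3: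
  fixes T :: nat and r :: "nat set \<Rightarrow> real" and D :: "nat \<Rightarrow> real set"
    and f fbar :: "nat \<Rightarrow> real \<Rightarrow> real" and K :: real and a b :: "nat \<Rightarrow> real"
    and \<mu>opt \<mu>hat :: "nat set \<Rightarrow> real" and lopt lhat :: real
  assumes "K > 0"
    and "I_sub T r D f"
    and "\<And>t. t \<in> {1..T} \<Longrightarrow> a t > 0"
    and "\<And>t y. t \<in> {1..T} \<Longrightarrow> fbar t y = K * exp y"
    and "\<And>t x. t \<in> {1..T} \<Longrightarrow> x \<in> D t \<Longrightarrow> f t x = a t * fbar t (x / a t + b t)"
    and "optimal_multipliers T r f \<mu>opt lopt"
    and "multiplier_le T (\<mu>hat, lhat) (\<mu>opt, lopt)"
    and "\<And>t. t \<in> {1..T} \<Longrightarrow> nu T \<mu>hat lhat t \<in> deriv_on (D t) (f t) ` D t"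
    and "\<And>t. t \<in> {1..T} \<Longrightarrow> nu T \<mu>opt lopt t \<in> deriv_on (D t) (f t) ` D t"
  shows "(\<Sum>t\<in>{1..T}. f t (deriv_inv (D t) (f t) (nu T \<mu>hat lhat t)))
           - (\<Sum>t\<in>{1..T}. f t (deriv_inv (D t) (f t) (nu T \<mu>opt lopt t)))
         = (\<Sum>t\<in>{1..T}. a t * nu T \<mu>hat lhat t) - (\<Sum>t\<in>{1..T}. a t * nu T \<mu>opt lopt t)
       \<and> (\<Sum>t\<in>{1..T}. f t (online_solution T r f \<mu>hat lhat t))
           - (\<Sum>t\<in>{1..T}. f t (online_solution T r f \<mu>opt lopt t))
         \<le> (\<Sum>t\<in>{1..T}. a t * nu T \<mu>hat lhat t) - (\<Sum>t\<in>{1..T}. a t * nu T \<mu>opt lopt t)"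
proof -
  \<comment> \<open>\<open>h\<close> extends the stage cost from \<open>D t\<close> to the whole
    line. The chain rule factor \<open>1 / a t\<close> cancels \<open>a t\<close>, so
    \<open>g t\<close> is the derivative of \<open>h t\<close>.\<close>
  define g where "g t x = K * exp (x / a t + b t)" for t x
  define h where "h t x = a t * g t x" for t x
  have sub: "submodular_on {1..T} r" "r {} = 0"
    using assms(2) unfolding I_sub_def by auto
  have D: "is_interval (D t)" "interior (D t) \<noteq> {}" "stage_set T r t \<subseteq> D t"
    "strictly_convex_on (D t) (f t)" "continuously_differentiable_on (f t) (D t)"
    if "t \<in> {1..T}" for t
    using assms(2) that unfolding I_sub_def by auto
  have fh: "f t x = h t x" if "t \<in> {1..T}" "x \<in> D t" for t x
    using assms(4,5) that by (simp add: h_def g_def)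
  have deriv: "(h t has_real_derivative g t x) (at x)" if "t \<in> {1..T}" for t x
    unfolding h_def g_def using assms(3)[OF that]
    by (auto intro!: derivative_eq_intros)
  have g_mono: "strict_mono (g t)" if "t \<in> {1..T}" for t
    using assms(1) assms(3)[OF that] by (auto simp: strict_mono_def g_def divide_strict_right_mono)
  have cont: "continuous_on (stage_set T r t) (f t)" if "t \<in> {1..T}" for t
    using D(3,5)[OF that] differentiable_imp_continuous_on continuous_on_subset
    unfolding continuously_differentiable_on_def by blast
  have sconv: "strictly_convex_on (stage_set T r t) (f t)" if "t \<in> {1..T}" for t
    using strictly_convex_on_subset[OF D(4,3)[OF that]] by (simp add: stage_set_def)
  \<comment> \<open>At the point where the derivative equals \<open>v\<close>, the cost is
    \<open>a t\<close> times that derivative. Summing this for both multipliers gives the claimed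
    equality.\<close>
  have inverse: "f t (deriv_inv (D t) (f t) v) = a t * v"
    if t: "t \<in> {1..T}" and v: "v \<in> deriv_on (D t) (f t) ` D t" for t v
  proof -
    let ?y = "deriv_inv (D t) (f t) v"
    have y: "?y \<in> D t" "deriv_on (D t) (f t) ?y = v"
      using v unfolding deriv_inv_def by (auto intro: inv_into_into f_inv_into_f)
    then have "g t ?y = v"
      using deriv_on_eq[OF D(1,2)[OF t] y(1) fh[OF t] deriv[OF t]] by simp
    then show ?thesis using fh[OF t y(1)] by (simp add: h_def)
  qed
  have zB: "local_solution T r f \<mu>opt lopt \<in> base_polyhedron T r"
    using assms(6) by (simp add: optimal_multipliers_def optimal_solution_def is_arg_min_def)
  have xB: "online_solution T r f \<mu>hat lhat \<in> base_polyhedron T r"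
    using online_solution_mem[OF cont sconv] zB by blast
  have "f t (online_solution T r f \<mu>hat lhat t) - f t (online_solution T r f \<mu>opt lopt t)
      \<le> a t * nu T \<mu>hat lhat t - a t * nu T \<mu>opt lopt t" if t: "t \<in> {1..T}" for t
  proof -
    let ?x = "online_solution T r f \<mu>hat lhat t" and ?z = "local_solution T r f \<mu>opt lopt t"
    have "g t ?x - nu T \<mu>hat lhat t \<le> g t ?z - nu T \<mu>opt lopt t"
      using fh D(3) by (intro online_marginal_le[where h = h] sub cont sconv deriv g_mono zB t
          nu_antimono[OF assms(7)]) auto
    then have "a t * (g t ?x - nu T \<mu>hat lhat t) \<le> a t * (g t ?z - nu T \<mu>opt lopt t)"
      using assms(3)[OF t] by (intro mult_left_mono) auto
    moreover have "f t ?x = a t * g t ?x" "f t ?z = a t * g t ?z"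
      using fh[OF t] D(3)[OF t] base_polyhedron_stage_set[OF xB t]
        base_polyhedron_stage_set[OF zB t] by (auto simp: h_def)
    \<comment> \<open>The local solution for the optimal multipliers is feasible, so the online
      procedure reproduces it.\<close>
    moreover have "online_solution T r f \<mu>opt lopt t = ?z"
      by (rule online_solution_eq_local_solution[OF cont sconv zB t])
    ultimately show ?thesis by (simp add: algebra_simps)
  qed
  then have "(\<Sum>t\<in>{1..T}. f t (online_solution T r f \<mu>hat lhat t)
        - f t (online_solution T r f \<mu>opt lopt t))
      \<le> (\<Sum>t\<in>{1..T}. a t * nu T \<mu>hat lhat t - a t * nu T \<mu>opt lopt t)"
    by (rule sum_mono)
  then show ?thesis
    using inverse assms(8,9) by (simp add: sum_subtractf)
qed

end
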